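(* Let $S$ be a finite set of integers and let $\omega \in S^{\mathbb{N}}$ be a word with bounded additive complexity. Then $\mathrm{slope}(\omega)$ is rational if and only if there exists some infinite collection $\mathcal{C}$ of (distinct, nonempty) factors of $\omega$ such that for any $B,B' \in \mathcal{C}$, $\mathrm{slope}(B) = \mathrm{slope}(B')$.
   Context: $\mathbb{N}$ denotes the positive integers. Alphabets are finite sets of integers. An infinite word over $S$ is a sequence $\omega = x_1x_2x_3\cdots$ with $x_i \in S$; $S^{\mathbb{N}}$ is the set of these. For $m \le n$, $\omega[m,n] = x_m x_{m+1}\cdots x_n$; the nonempty factors of $\omega$ are the finite words of this form (a collection of factors is a set of words, so repeated occurrences of a word count once). $|B|$ is the length of a finite word $B$, and $\sum B$ is the sum of its letters. $\omega$ has bounded additive complexity if there is $M\in\mathbb{N}$ such that for every $n\in\mathbb{N}$ the set $\{\sum B : B \text{ a factor of } \omega,\ |B|=n\}$ has at most $M$ elements. For a nonempty finite word $B$, $\mathrm{slope}(B) = \frac{1}{|B|}\sum B$; for an infinite word, $\mathrm{slope}(\omega) = \lim_{n\to\infty} \mathrm{slope}(\omega[1,n])$, if this limit exists (it exists whenever $\omega$ has bounded additive complexity). *)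

theory Defs
  imports "HOL-Analysis.Analysis"
begin

text \<open>
  An infinite word \<open>x\<^sub>1 x\<^sub>2 x\<^sub>3 \<dots>\<close> is a function \<open>\<omega>\<close> on \<^typ>\<open>nat\<close> whose letters are \<open>\<omega> i\<close> for
  \<open>i \<ge> 1\<close>. The value \<open>\<omega> 0\<close> is not part of the word: no definition below reads it when the
  starting index is at least \<open>1\<close>. Finite words are lists.
\<close>

definition infinite_words :: "int set \<Rightarrow> (nat \<Rightarrow> int) set" where
  "infinite_words S = {1..} \<rightarrow> S"

definition subword :: "(nat \<Rightarrow> int) \<Rightarrow> nat \<Rightarrow> nat \<Rightarrow> int list" where
  "subword \<omega> m n = map \<omega> [m..<Suc n]"

definition factors :: "(nat \<Rightarrow> int) \<Rightarrow> int list set" where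
  "factors \<omega> = {subword \<omega> m n | m n. 1 \<le> m \<and> m \<le> n}"

definition factor_sums :: "(nat \<Rightarrow> int) \<Rightarrow> nat \<Rightarrow> int set" where
  "factor_sums \<omega> n = {sum_list B | B. B \<in> factors \<omega> \<and> length B = n}"

text \<open>Finiteness is required explicitly because \<^const>\<open>card\<close> is \<open>0\<close> on infinite sets.\<close>

definition bounded_additive_complexity :: "(nat \<Rightarrow> int) \<Rightarrow> bool" where
  "bounded_additive_complexity \<omega> \<longleftrightarrow>
     (\<exists>M\<ge>1. \<forall>n\<ge>1. finite (factor_sums \<omega> n) \<and> card (factor_sums \<omega> n) \<le> M)"

definition slope :: "int list \<Rightarrow> real" where
  "slope B = real_of_int (sum_list B) / real (length B)"

text \<open>
  As usual for \<^const>\<open>lim\<close>, this is the limit whenever it exists, and unspecified otherwise.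
  The term at \<open>n = 0\<close>, the empty word, does not affect the limit.
\<close>

definition word_slope :: "(nat \<Rightarrow> int) \<Rightarrow> real" where
  "word_slope \<omega> = lim (\<lambda>n. slope (subword \<omega> 1 n))"

end

theory Submission
  imports Defs
begin

text \<open>
  The sums of consecutive windows of length \<open>n\<close> differ by a bounded amount, so a bounded number
  of values forces these sums into an interval of bounded width, uniformly in \<open>n\<close>. Hence the
  prefix sums are additive up to a bounded error, and there is \<open>\<alpha>\<close>, the slope of the word, such that
  every factor \<open>B\<close> satisfies \<open>\<bar>\<Sum> B - |B| \<alpha>\<bar> \<le> c\<close> for a constant \<open>c\<close>. If \<open>\<alpha> = p / q\<close>, the
  bounded integers \<open>q (x\<^sub>1 + \<dots> + x\<^sub>n) - p n\<close> take one value infinitely often, and the factors between two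
  such positions have slope \<open>\<alpha>\<close>. Conversely, infinitely many factors of a common slope \<open>s\<close> have unbounded
  lengths, which forces \<open>s = \<alpha>\<close>.
\<close>

section \<open>Factors as differences of prefix sums\<close>

lemma sum_list_subword: "sum_list (subword \<omega> m n) = sum \<omega> {m..n}"
  by (simp add: subword_def interv_sum_list_conv_sum_set_nat atLeastLessThanSuc_atLeastAtMost
      del: upt_Suc)

lemma length_subword: "length (subword \<omega> m n) = Suc n - m"
  by (simp add: subword_def del: upt_Suc)

text \<open>A window is indexed by the position \<open>m\<close> just before it and by its length
  \<open>n\<close>. Thus \<open>m = 0\<close> gives prefixes, and no subtraction of naturals is
  needed.\<close>

lemma sum_window:
  fixes \<omega> :: "nat \<Rightarrow> int"
  shows "sum \<omega> {Suc m..m + n} = sum \<omega> {1..m + n} - sum \<omega> {1..m}"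
  using sum.ub_add_nat[of 1 m \<omega> n] by simp

lemma factor_obtain:
  assumes "B \<in> factors \<omega>"
  obtains m where "B = subword \<omega> (Suc m) (m + length B)" "1 \<le> length B"
proof -
  from assms obtain a b where ab: "B = subword \<omega> a b" "1 \<le> a" "a \<le> b"
    by (auto simp: factors_def)
  then have "length B = Suc b - a" by (simp add: length_subword)
  with ab have "B = subword \<omega> (Suc (a - 1)) ((a - 1) + length B)" "1 \<le> length B" by auto
  then show ?thesis by (rule that)
qed

lemma window_in_factors: "1 \<le> n \<Longrightarrow> subword \<omega> (Suc m) (m + n) \<in> factors \<omega>"
  unfolding factors_def by (intro CollectI exI[of _ "Suc m"] exI[of _ "m + n"]) simp

section \<open>Integer sequences with small steps and few values\<close>

text \<open>With steps of at most 1 no integer between two values is skipped, so the whole interval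
  from \<open>g a\<close> to \<open>g b\<close> lies in the range.\<close>

lemma card_range_ge_unit_steps:
  fixes g :: "nat \<Rightarrow> int"
  assumes step: "\<And>i. \<bar>g (Suc i) - g i\<bar> \<le> 1" and fin: "finite (range g)"
  shows "g b - g a < int (card (range g))"
proof (cases "g a \<le> g b")
  case True
  have "{g a..g b} \<subseteq> range g"
  proof
    fix k assume k: "k \<in> {g a..g b}"
    show "k \<in> range g"
    proof (cases "a \<le> b")
      case True
      then show ?thesis using nat_intermed_int_val[of a b g k] step k by auto
    next
      case False
      \<comment> \<open>Here the larger value comes first; negating \<open>g\<close> gives the
        upward crossing that the discrete intermediate value theorem expects.\<close>
      have "\<bar>- g (Suc i) - - g i\<bar> \<le> 1" for i using step[of i] by linarith
      then have "\<exists>i\<ge>b. i \<le> a \<and> - g i = - k"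
        using False k by (intro nat_intermed_int_val) auto
      then show ?thesis by auto
    qed
  qed
  then have "card {g a..g b} \<le> card (range g)" by (rule card_mono[OF fin])
  then show ?thesis using True by simp
next
  case False
  have "card (range g) > 0" using fin by (simp add: card_gt_0_iff)
  then show ?thesis using False by linarith
qed

text \<open>Dividing by \<open>D\<close> with rounding turns steps of size at most \<open>D\<close>
  into steps of at most 1 and cannot increase the number of values.\<close>

lemma range_width_le_card:
  fixes x :: "nat \<Rightarrow> int"
  assumes D: "D \<ge> 1" and step: "\<And>i. \<bar>x (Suc i) - x i\<bar> \<le> D"
    and fin: "finite (range x)" and card: "card (range x) \<le> M"
  shows "x b - x a \<le> int M * D"
proof -
  define g where "g i = x i div D" for i
  have rg: "range g = (\<lambda>v. v div D) ` range x" by (auto simp: g_def)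
  have "finite (range g)" "card (range g) \<le> M"
    using fin card card_image_le[OF fin, of "\<lambda>v. v div D"] by (auto simp: rg)
  moreover have "\<bar>g (Suc i) - g i\<bar> \<le> 1" for i
  proof -
    have "x (Suc i) \<le> x i + D" "x i - D \<le> x (Suc i)" using step[of i] by linarith+
    then have "x (Suc i) div D \<le> (x i + D) div D" "(x i - D) div D \<le> x (Suc i) div D"
      using D by (simp_all only: zdiv_mono1)
    moreover have "(x i + D) div D = x i div D + 1" "(x i - D) div D = x i div D - 1"
      using D div_add_self2[of D "x i"] div_add_self2[of D "x i - D"] by auto
    ultimately show ?thesis by (simp add: g_def)
  qed
  ultimately have "g b - g a < int M"
    using card_range_ge_unit_steps[of g b a] by fastforce
  \<comment> \<open>The strict inequality between integers leaves one spare \<open>D\<close>, which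
    absorbs the remainders lost in rounding.\<close>
  then have le: "(g b - g a + 1) * D \<le> int M * D" using D by (intro mult_right_mono) auto
  have "x b = g b * D + x b mod D" "x a = g a * D + x a mod D" by (auto simp: g_def)
  moreover have "x b mod D < D" "0 \<le> x a mod D" using D by auto
  ultimately have "x b - x a \<le> g b * D + D - g a * D" by linarith
  also have "\<dots> = (g b - g a + 1) * D" by (simp add: algebra_simps)
  finally show ?thesis using le by linarith
qed

section \<open>Real sequences additive up to a bounded error\<close>

text \<open>Both \<open>m * P n\<close> and \<open>n * P m\<close> approximate
  \<open>P (m * n)\<close>, with errors \<open>m * c\<close> and \<open>n * c\<close>. Dividing by
  \<open>m * n\<close> puts the averages at \<open>m\<close> and \<open>n\<close> within
  \<open>c / n + c / m\<close> of each other, so they form a Cauchy sequence.\<close>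

lemma quasi_additive_slope:
  fixes P :: "nat \<Rightarrow> real"
  assumes quasi: "\<And>m n. \<bar>P (m + n) - P m - P n\<bar> \<le> c"
  obtains \<alpha> where "(\<lambda>n. P n / real n) \<longlonglongrightarrow> \<alpha>" "\<And>n. \<bar>P n - real n * \<alpha>\<bar> \<le> c"
proof -
  have c: "c \<ge> 0" using quasi[of 0 0] by linarith
  have mult: "\<bar>P (k * n) - real k * P n\<bar> \<le> real k * c" if "k \<ge> 1" for k n
    using that
  proof (induction k rule: dec_induct)
    case base
    then show ?case using c by simp
  next
    case (step k)
    have "\<bar>P (Suc k * n) - P n - P (k * n)\<bar> \<le> c"
      using quasi[of n "k * n"] by simp
    moreover have "real (Suc k) * P n = real k * P n + P n" "real (Suc k) * c = real k * c + c"
      by (simp_all add: distrib_right)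
    ultimately show ?case using step.IH by linarith
  qed
  have cross: "\<bar>real m * P n - real n * P m\<bar> \<le> (real m + real n) * c" if "m \<ge> 1" "n \<ge> 1" for m n
  proof -
    have "\<bar>P (m * n) - real m * P n\<bar> \<le> real m * c" "\<bar>P (m * n) - real n * P m\<bar> \<le> real n * c"
      using mult[of m n] mult[of n m] that by (simp_all add: mult.commute)
    then show ?thesis unfolding distrib_right by linarith
  qed
  have diff: "\<bar>P n / real n - P m / real m\<bar> \<le> c / real n + c / real m" if "m \<ge> 1" "n \<ge> 1" for m n
  proof -
    have "P n / real n - P m / real m = (real m * P n - real n * P m) / (real m * real n)"
      using that by (simp add: field_simps)
    then have "\<bar>P n / real n - P m / real m\<bar> = \<bar>real m * P n - real n * P m\<bar> / (real m * real n)"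
      by (simp add: abs_mult)
    also have "\<dots> \<le> (real m + real n) * c / (real m * real n)"
      using cross[OF that] by (intro divide_right_mono) auto
    also have "\<dots> = c / real n + c / real m" using that by (simp add: field_simps)
    finally show ?thesis .
  qed
  have "Cauchy (\<lambda>n. P n / real n)"
  proof (rule metric_CauchyI)
    fix e :: real assume e: "e > 0"
    obtain N :: nat where N: "2 * c / e < real N" using reals_Archimedean2 by blast
    have small: "c / real n < e / 2" if "n \<ge> Suc N" for n
    proof -
      have "2 * c / e < real n" using N that by linarith
      then show ?thesis using e that by (simp add: field_simps)
    qed
    have "dist (P m / real m) (P n / real n) < e" if "m \<ge> Suc N" "n \<ge> Suc N" for m n
      using diff[of n m] small[OF that(1)] small[OF that(2)] that
      unfolding dist_real_def by linarith
    then show "\<exists>N. \<forall>m\<ge>N. \<forall>n\<ge>N. dist (P m / real m) (P n / real n) < e" by blast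
  qed
  then obtain \<alpha> where lim: "(\<lambda>n. P n / real n) \<longlonglongrightarrow> \<alpha>"
    unfolding Cauchy_convergent_iff convergent_def by blast
  have "\<bar>P n - real n * \<alpha>\<bar> \<le> c" for n
  proof (cases "n = 0")
    case True
    then show ?thesis using quasi[of 0 0] by simp
  next
    case False
    \<comment> \<open>Letting \<open>m\<close> grow in \<open>diff\<close> with \<open>n\<close>
      fixed removes \<open>c / m\<close>; multiplying by \<open>n\<close> then leaves exactly the
      constant \<open>c\<close>.\<close>
    have "(\<lambda>m. c / real n + c / real m) \<longlonglongrightarrow> c / real n + 0"
      by (intro tendsto_add tendsto_const lim_const_over_n)
    moreover have "(\<lambda>m. \<bar>P n / real n - P m / real m\<bar>) \<longlonglongrightarrow> \<bar>P n / real n - \<alpha>\<bar>"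
      by (intro tendsto_intros lim)
    moreover have "\<forall>\<^sub>F m in sequentially. \<bar>P n / real n - P m / real m\<bar> \<le> c / real n + c / real m"
      using eventually_ge_at_top[of 1] by eventually_elim (use diff False in auto)
    ultimately have "\<bar>P n / real n - \<alpha>\<bar> \<le> c / real n + 0"
      by (intro tendsto_le[OF sequentially_bot])
    then have "\<bar>P n / real n - \<alpha>\<bar> * real n \<le> c / real n * real n"
      by (intro mult_right_mono) auto
    moreover have "\<bar>P n / real n - \<alpha>\<bar> * real n = \<bar>(P n / real n - \<alpha>) * real n\<bar>"
      by (simp add: abs_mult)
    ultimately show ?thesis using False by (simp add: algebra_simps)
  qed
  with lim show ?thesis by (rule that)
qed

section \<open>Deviation of factor sums from the slope\<close>

lemma window_sums_close:
  assumes S: "finite S" "\<omega> \<in> infinite_words S" and bac: "bounded_additive_complexity \<omega>"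
  obtains c :: int where
    "\<And>m m' n. \<bar>sum \<omega> {Suc m..m + n} - sum \<omega> {Suc m'..m' + n}\<bar> \<le> c"
proof -
  obtain K where K: "\<And>s. s \<in> S \<Longrightarrow> \<bar>s\<bar> \<le> K"
    using that[of "Max (abs ` S)"] S(1) by simp
  have letter: "\<bar>\<omega> i\<bar> \<le> K" if "i \<ge> 1" for i
    using S(2) that by (auto simp: infinite_words_def intro!: K)
  have K0: "K \<ge> 0" using letter[of 1] by simp
  obtain M where M: "\<And>n. n \<ge> 1 \<Longrightarrow> finite (factor_sums \<omega> n) \<and> card (factor_sums \<omega> n) \<le> M"
    using bac by (auto simp: bounded_additive_complexity_def)
  have main: "sum \<omega> {Suc m..m + n} - sum \<omega> {Suc m'..m' + n} \<le> int M * (2 * K + 1)" for m m' n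
  proof (cases "n = 0")
    case False
    define x where "x m = sum \<omega> {Suc m..m + n}" for m
    have "x m \<in> factor_sums \<omega> n" for m
      unfolding factor_sums_def mem_Collect_eq
      by (intro exI[of _ "subword \<omega> (Suc m) (m + n)"])
        (use False window_in_factors[of n \<omega> m] in
          \<open>simp add: x_def sum_list_subword length_subword\<close>)
    then have "range x \<subseteq> factor_sums \<omega> n" by blast
    then have "finite (range x)" "card (range x) \<le> M"
      using M[of n] False card_mono[of "factor_sums \<omega> n" "range x"]
      by (auto simp: finite_subset)
    \<comment> \<open>Shifting a window by one gains one letter and loses one. The added 1 keeps the
      step bound positive when \<open>K = 0\<close>.\<close>
    moreover have "\<bar>x (Suc i) - x i\<bar> \<le> 2 * K + 1" for i
    proof -
      have "x (Suc i) - x i = \<omega> (Suc i + n) - \<omega> (Suc i)"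
        by (simp only: x_def sum_window) simp
      then show ?thesis using letter[of "Suc i + n"] letter[of "Suc i"] by simp
    qed
    ultimately show ?thesis
      using range_width_le_card[of "2 * K + 1" x M m m'] K0 by (simp add: x_def)
  qed (use K0 in simp)
  show ?thesis
    by (rule that[of "int M * (2 * K + 1)"]) (use main in \<open>auto simp: abs_le_iff\<close>)
qed

lemma factor_sums_near_slope:
  assumes "finite S" "\<omega> \<in> infinite_words S" "bounded_additive_complexity \<omega>"
  obtains c where
    "\<And>B. B \<in> factors \<omega> \<Longrightarrow> \<bar>real_of_int (sum_list B) - real (length B) * word_slope \<omega>\<bar> \<le> c"
proof -
  obtain c where c: "\<And>m m' n. \<bar>sum \<omega> {Suc m..m + n} - sum \<omega> {Suc m'..m' + n}\<bar> \<le> c"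
    using window_sums_close[OF assms] by blast
  define P where "P n = real_of_int (sum \<omega> {1..n})" for n
  have win: "real_of_int (sum \<omega> {Suc m..m + n}) = P (m + n) - P m" for m n
    unfolding sum_window P_def by simp
  have quasi: "\<bar>P (m + n) - P m - P n\<bar> \<le> real_of_int c" for m n
  proof -
    \<comment> \<open>Comparing a window with the prefix of the same length is exactly
      quasi-additivity of \<open>P\<close>.\<close>
    have "real_of_int \<bar>sum \<omega> {Suc m..m + n} - sum \<omega> {Suc 0..0 + n}\<bar> \<le> real_of_int c"
      using c by (simp only: of_int_le_iff)
    then show ?thesis by (simp only: of_int_abs of_int_diff win) (simp add: P_def)
  qed
  obtain \<alpha> where lim: "(\<lambda>n. P n / real n) \<longlonglongrightarrow> \<alpha>"
    and near: "\<And>n. \<bar>P n - real n * \<alpha>\<bar> \<le> real_of_int c"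
    using quasi_additive_slope[of P, OF quasi] by blast
  have "word_slope \<omega> = \<alpha>"
    using limI[OF lim]
    by (simp add: word_slope_def slope_def sum_list_subword length_subword P_def)
  \<comment> \<open>One \<open>c\<close> moves the window to the prefix of the same length, the
    other compares that prefix with the slope.\<close>
  moreover have "\<bar>real_of_int (sum_list B) - real (length B) * \<alpha>\<bar> \<le> 2 * real_of_int c"
    if B: "B \<in> factors \<omega>" for B
  proof -
    obtain m where m: "B = subword \<omega> (Suc m) (m + length B)" using factor_obtain[OF B] by blast
    have "real_of_int (sum_list B) = P (m + length B) - P m"
      by (subst m) (simp only: sum_list_subword win)
    then show ?thesis using quasi[of m "length B"] near[of "length B"] by linarith
  qed
  ultimately show ?thesis using that by blast
qed

section \<open>Rational slope and factors of equal slope\<close>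

lemma infinite_equal_slopes_if_rational:
  assumes near: "\<And>B. B \<in> factors \<omega> \<Longrightarrow> \<bar>real_of_int (sum_list B) - real (length B) * \<alpha>\<bar> \<le> c"
    and rat: "\<alpha> \<in> \<rat>"
  shows "\<exists>C. infinite C \<and> C \<subseteq> factors \<omega> \<and> (\<forall>B\<in>C. slope B = \<alpha>)"
proof -
  from rat obtain p q :: int where q: "q > 0" and \<alpha>: "\<alpha> = real_of_int p / real_of_int q"
    by (auto elim!: Rats_cases')
  \<comment> \<open>This is \<open>q\<close> times the deviation of the prefix sum from
    \<open>n * \<alpha>\<close>, hence an integer bounded by \<open>q * c\<close> in absolute
    value.\<close>
  define h where "h n = q * sum \<omega> {1..n} - p * int n" for n
  have "h n \<in> {- \<lceil>real_of_int q * c\<rceil>..\<lceil>real_of_int q * c\<rceil>}" if n: "n \<ge> 1" for n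
  proof -
    have "\<bar>real_of_int (sum \<omega> {1..n}) - real n * \<alpha>\<bar> \<le> c"
      using near[OF window_in_factors[of n \<omega> 0]] n by (simp add: sum_list_subword length_subword)
    then have "real_of_int q * \<bar>real_of_int (sum \<omega> {1..n}) - real n * \<alpha>\<bar> \<le> real_of_int q * c"
      using q by (intro mult_left_mono) auto
    moreover have "real_of_int (h n) = real_of_int q * (real_of_int (sum \<omega> {1..n}) - real n * \<alpha>)"
      using q by (simp add: h_def \<alpha> field_simps)
    ultimately have "\<bar>real_of_int (h n)\<bar> \<le> real_of_int q * c" using q by (simp add: abs_mult)
    then have "real_of_int \<bar>h n\<bar> \<le> real_of_int q * c" by simp
    then have "\<bar>h n\<bar> \<le> \<lceil>real_of_int q * c\<rceil>" by linarith
    then show ?thesis by auto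
  qed
  then have "finite (h ` {1..})" by (meson finite_atLeastAtMost_int finite_subset image_subsetI atLeast_iff)
  then obtain n0 where n0: "n0 \<ge> 1" "infinite {n \<in> {1..}. h n = h n0}"
    using pigeonhole_infinite[of "{1..}" h] infinite_Ici by auto
  \<comment> \<open>Dropping the finitely many positions up to \<open>n0\<close> makes every window
    from \<open>Suc n0\<close> to \<open>n\<close> nonempty.\<close>
  define A where "A = {n \<in> {1..}. h n = h n0} - {..n0}"
  have infA: "infinite A" using n0(2) by (simp add: A_def)
  define w where "w n = subword \<omega> (Suc n0) n" for n
  \<comment> \<open>All windows start at the same place, so different end points give different
    lengths and therefore distinct words.\<close>
  have "inj_on w A"
  proof (rule inj_onI)
    fix m n assume "m \<in> A" "n \<in> A" "w m = w n"
    then have "length (w m) = length (w n)" "m > n0" "n > n0" by (auto simp: A_def)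
    then show "m = n" by (simp add: w_def length_subword)
  qed
  then have "infinite (w ` A)" using infA finite_imageD by blast
  moreover have "w ` A \<subseteq> factors \<omega>" by (fastforce simp: w_def A_def factors_def)
  moreover have "slope (w n) = \<alpha>" if "n \<in> A" for n
  proof -
    from that have n: "n > n0" "h n = h n0" by (auto simp: A_def)
    have "q * sum \<omega> {Suc n0..n} = p * (int n - int n0)"
      using n sum_window[of \<omega> n0 "n - n0"] by (simp add: h_def right_diff_distrib)
    then have "real_of_int (q * sum \<omega> {Suc n0..n}) = real_of_int (p * (int n - int n0))"
      by simp
    then show ?thesis
      using n q by (simp add: slope_def w_def sum_list_subword length_subword \<alpha> of_nat_diff field_simps)
  qed
  ultimately show ?thesis by (intro exI[of _ "w ` A"]) auto
qed

text \<open>Over a finite alphabet there are only finitely many words of length at most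
  \<open>N\<close>.\<close>

lemma factor_length_unbounded:
  assumes S: "finite S" "\<omega> \<in> infinite_words S" and C: "infinite C" "C \<subseteq> factors \<omega>"
  shows "\<exists>B\<in>C. N < length B"
proof (rule ccontr)
  assume "\<not> ?thesis"
  moreover have "set B \<subseteq> S" if "B \<in> factors \<omega>" for B
    using that S(2) by (fastforce simp: factors_def subword_def infinite_words_def simp del: upt_Suc)
  ultimately have "C \<subseteq> {B. set B \<subseteq> S \<and> length B \<le> N}" using C(2) by fastforce
  then show False using C(1) finite_lists_length_le[OF S(1)] finite_subset by blast
qed

text \<open>A word of slope \<open>s\<close> deviates from \<open>\<alpha>\<close> times its length
  by its length times \<open>\<bar>s - \<alpha>\<bar>\<close>, which cannot stay below
  \<open>c\<close> for arbitrarily long words unless \<open>s = \<alpha>\<close>.\<close>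

lemma common_slope_eq:
  assumes near: "\<And>B. B \<in> C \<Longrightarrow> \<bar>real_of_int (sum_list B) - real (length B) * \<alpha>\<bar> \<le> c"
    and long: "\<And>N. \<exists>B\<in>C. N < length B" and slope: "\<And>B. B \<in> C \<Longrightarrow> slope B = s"
  shows "s = \<alpha>"
proof (rule ccontr)
  assume "s \<noteq> \<alpha>"
  obtain N :: nat where N: "c / \<bar>s - \<alpha>\<bar> < real N" using reals_Archimedean2 by blast
  obtain B where B: "B \<in> C" "N < length B" using long by blast
  have "real_of_int (sum_list B) = s * real (length B)"
    using slope[OF B(1)] B(2) by (auto simp: slope_def field_simps)
  then have "real_of_int (sum_list B) - real (length B) * \<alpha> = real (length B) * (s - \<alpha>)"
    by (simp add: algebra_simps)
  then have "real (length B) * \<bar>s - \<alpha>\<bar> \<le> c" using near[OF B(1)] by (simp add: abs_mult)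
  then have "real (length B) \<le> c / \<bar>s - \<alpha>\<bar>" using \<open>s \<noteq> \<alpha>\<close> by (simp add: field_simps)
  then show False using N B(2) by linarith
qed

theorem lemma2p3:
  fixes S :: "int set" and \<omega> :: "nat \<Rightarrow> int"
  assumes "finite S"
    and "\<omega> \<in> infinite_words S"
    and "bounded_additive_complexity \<omega>"
  shows "word_slope \<omega> \<in> \<rat> \<longleftrightarrow>
    (\<exists>C. infinite C \<and> C \<subseteq> factors \<omega> \<and> (\<forall>B\<in>C. \<forall>B'\<in>C. slope B = slope B'))"
proof -
  obtain c where near: "\<And>B. B \<in> factors \<omega> \<Longrightarrow>
      \<bar>real_of_int (sum_list B) - real (length B) * word_slope \<omega>\<bar> \<le> c"
    using factor_sums_near_slope[OF assms] by blast
  show ?thesis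
  proof
    assume "word_slope \<omega> \<in> \<rat>"
    then show "\<exists>C. infinite C \<and> C \<subseteq> factors \<omega> \<and> (\<forall>B\<in>C. \<forall>B'\<in>C. slope B = slope B')"
      using infinite_equal_slopes_if_rational[OF near] by fastforce
  next
    assume "\<exists>C. infinite C \<and> C \<subseteq> factors \<omega> \<and> (\<forall>B\<in>C. \<forall>B'\<in>C. slope B = slope B')"
    then obtain C where C: "infinite C" "C \<subseteq> factors \<omega>"
      and eq: "\<And>B B'. B \<in> C \<Longrightarrow> B' \<in> C \<Longrightarrow> slope B = slope B'" by blast
    obtain B where B: "B \<in> C" using C(1) by fastforce
    have "slope B = word_slope \<omega>"
    proof (rule common_slope_eq[where C = C])
      show "\<exists>B\<in>C. N < length B" for N by (rule factor_length_unbounded[OF assms(1,2) C])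
      show "slope B' = slope B" if "B' \<in> C" for B' by (rule eq[OF that B])
    qed (use near C(2) in blast)
    \<comment> \<open>The slope of a finite word is a quotient of integers.\<close>
    moreover have "slope B \<in> \<rat>" by (simp add: slope_def)
    ultimately show "word_slope \<omega> \<in> \<rat>" by simp
  qed
qed

end
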